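(* Let $K$ be a field. Then the group $PSL(2,K)$ is not CSA.
   Context: A subgroup $H$ of a group $G$ is malnormal in $G$ if $g^{-1}Hg \cap H = \{1\}$ for every $g \in G \setminus H$. A group $G$ is CSA (conjugately separated abelian) if every maximal abelian subgroup of $G$ is malnormal in $G$. $PSL(2,K) = SL(2,K)/\{\pm I\}$. *)

theory Defs
  imports "HOL-Analysis.Determinants" "HOL-Algebra.Coset"
begin

definition malnormal :: "'a set \<Rightarrow> ('a, 'b) monoid_scheme \<Rightarrow> bool" where
  "malnormal H G \<longleftrightarrow>
     subgroup H G \<and>
     (\<forall>g \<in> carrier G - H. ((inv\<^bsub>G\<^esub> g <#\<^bsub>G\<^esub> H) #>\<^bsub>G\<^esub> g) \<inter> H = {\<one>\<^bsub>G\<^esub>})"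

definition abelian_subgroup :: "'a set \<Rightarrow> ('a, 'b) monoid_scheme \<Rightarrow> bool" where
  "abelian_subgroup H G \<longleftrightarrow> subgroup H G \<and> comm_group (G\<lparr>carrier := H\<rparr>)"

definition maximal_abelian_subgroup :: "'a set \<Rightarrow> ('a, 'b) monoid_scheme \<Rightarrow> bool" where
  "maximal_abelian_subgroup H G \<longleftrightarrow>
     abelian_subgroup H G \<and> (\<forall>A. abelian_subgroup A G \<longrightarrow> H \<subseteq> A \<longrightarrow> A = H)"

text \<open>To be applied to groups only.\<close>

definition CSA :: "('a, 'b) monoid_scheme \<Rightarrow> bool" where
  "CSA G \<longleftrightarrow> (\<forall>H. maximal_abelian_subgroup H G \<longrightarrow> malnormal H G)"

definition SL2 :: "('k::field ^ 2 ^ 2) monoid" where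
  "SL2 = \<lparr>carrier = {A. det A = 1}, mult = (**), one = mat 1\<rparr>"

text \<open>In characteristic 2 the two elements of the subgroup coincide and the quotient is
  \<^const>\<open>SL2\<close> modulo the trivial subgroup.\<close>

definition PSL2 :: "('k::field ^ 2 ^ 2) set monoid" where
  "PSL2 = SL2 Mod {mat 1, - mat 1}"

lemma group_SL2: "group (SL2 :: ('k::field ^ 2 ^ 2) monoid)"
proof (rule groupI)
  fix A :: "'k ^ 2 ^ 2"
  assume "A \<in> carrier SL2"
  then have d: "det A = 1" by (simp add: SL2_def)
  then have "invertible A" by (simp add: invertible_det_nz)
  then obtain B where B: "B ** A = mat 1" by (auto simp: invertible_def)
  then have "det B * det A = 1" by (metis det_mul det_I)
  then have "det B = 1" using d by simp
  with B show "\<exists>B \<in> carrier SL2. B \<otimes>\<^bsub>SL2\<^esub> A = \<one>\<^bsub>SL2\<^esub>"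
    by (auto simp: SL2_def)
qed (auto simp: SL2_def det_mul matrix_mul_assoc)

lemma normal_pm_one_SL2: "{mat 1, - mat 1} \<lhd> (SL2 :: ('k::field ^ 2 ^ 2) monoid)"
proof -
  interpret group "SL2 :: ('k ^ 2 ^ 2) monoid" by (rule group_SL2)
  have l: "- mat 1 ** A = - A" and r: "A ** - mat 1 = - A" for A :: "'k ^ 2 ^ 2"
    by (simp_all add: vec_eq_iff matrix_matrix_mult_def mat_def sum_2 forall_2)
  have c: "- mat 1 \<in> carrier (SL2 :: ('k ^ 2 ^ 2) monoid)"
    by (simp add: SL2_def det_2 mat_def)
  have i: "inv\<^bsub>SL2\<^esub> (- mat 1) = (- mat 1 :: 'k ^ 2 ^ 2)"
    by (rule inv_equality) (use c l in \<open>auto simp: SL2_def\<close>)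
  have i1: "inv\<^bsub>SL2\<^esub> (mat 1) = (mat 1 :: 'k ^ 2 ^ 2)"
    using inv_one by (simp add: SL2_def)
  have s: "subgroup {mat 1, - mat 1} (SL2 :: ('k ^ 2 ^ 2) monoid)"
    by (rule subgroup.intro) (use c i i1 l r in \<open>auto simp: SL2_def\<close>)
  show ?thesis
    by (rule normalI[OF s]) (auto simp: r_coset_def l_coset_def SL2_def l r)
qed

lemma group_PSL2: "group (PSL2 :: ('k::field ^ 2 ^ 2) set monoid)"
  unfolding PSL2_def by (rule normal.factorgroup_is_group[OF normal_pm_one_SL2])

end

theory Submission imports Defs begin

text \<open>
  In a CSA group an element \<open>x\<close> that commutes with its conjugate \<open>g\<^sup>-\<^sup>1 x g\<close> already commutes with
  \<open>g\<close>: a maximal abelian subgroup through \<open>x\<close> and \<open>g\<^sup>-\<^sup>1 x g\<close> meets its conjugate by \<open>g\<close> in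
  \<open>g\<^sup>-\<^sup>1 x g\<close>, so malnormality leaves only \<open>x = 1\<close> or \<open>g\<close> in that subgroup
  (\<open>CSA_commutes_if_commutes_with_conjugate\<close>).

  So it is enough to exhibit, over every field, two matrices \<open>x\<close> and \<open>g\<close> of determinant \<open>1\<close> such that
  \<open>x\<close> commutes with \<open>g\<^sup>-\<^sup>1 x g\<close> up to sign, but not with \<open>g\<close>. If \<open>6 \<noteq> 0\<close>, the diagonal matrix
  with entries \<open>2\<close> and \<open>1/2\<close> rescales the abelian group of upper unitriangular matrices by a factor
  other than \<open>1\<close>. The prime fields of characteristic 2 and 3 have no suitable diagonal matrix, and there
  the small groups decide: \<open>PSL(2,2)\<close> is the symmetric group on three letters, where an involution
  inverts an element of order 3, and \<open>PSL(2,3)\<close> is the alternating group on four letters, where an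
  element of order 3 permutes the involutions of the Klein four-group. These configurations persist in
  every field of the same characteristic.
\<close>

section \<open>Maximal abelian subgroups\<close>

text \<open>A maximal set of pairwise commuting elements is its own centralizer, hence automatically a
  subgroup. So Zorn's lemma can be applied to commuting sets, without generating
  subgroups.\<close>

lemma (in group) commuting_set_in_maximal_abelian_subgroup:
  assumes C: "C \<subseteq> carrier G"
    and comm: "\<And>a b. \<lbrakk>a \<in> C; b \<in> C\<rbrakk> \<Longrightarrow> a \<otimes> b = b \<otimes> a"
  obtains M where "maximal_abelian_subgroup M G" "C \<subseteq> M"
proof -
  define F where
    "F = {S. C \<subseteq> S \<and> S \<subseteq> carrier G \<and> (\<forall>a\<in>S. \<forall>b\<in>S. a \<otimes> b = b \<otimes> a)}"
  have "C \<in> F"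
    using C comm by (auto simp: F_def)
  have chain: "\<Union>\<C> \<in> F" if "\<C> \<noteq> {}" and "subset.chain F \<C>" for \<C>
  proof -
    have CF: "\<C> \<subseteq> F" and lin: "\<And>X Y. \<lbrakk>X \<in> \<C>; Y \<in> \<C>\<rbrakk> \<Longrightarrow> X \<subseteq> Y \<or> Y \<subseteq> X"
      using that(2) by (auto simp: subset_chain_def)
    have "a \<otimes> b = b \<otimes> a" if ab: "X \<in> \<C>" "a \<in> X" "Y \<in> \<C>" "b \<in> Y" for a b X Y
    proof -
      obtain Z where "Z \<in> \<C>" "a \<in> Z" "b \<in> Z"
        using lin[OF ab(1,3)] ab by blast
      then show ?thesis
        using CF by (auto simp: F_def)
    qed
    moreover have "C \<subseteq> \<Union>\<C>" "\<Union>\<C> \<subseteq> carrier G"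
      using CF \<open>\<C> \<noteq> {}\<close> unfolding F_def by blast+
    ultimately show ?thesis
      unfolding F_def by blast
  qed
  obtain M where M: "M \<in> F" and max: "\<And>X. \<lbrakk>X \<in> F; M \<subseteq> X\<rbrakk> \<Longrightarrow> X = M"
    using subset_Zorn_nonempty[of F] \<open>C \<in> F\<close> chain by blast
  have CM: "C \<subseteq> M" and MG: "M \<subseteq> carrier G"
    and Mcomm: "\<And>a b. \<lbrakk>a \<in> M; b \<in> M\<rbrakk> \<Longrightarrow> a \<otimes> b = b \<otimes> a"
    using M by (auto simp: F_def)
  have centralizer: "z \<in> M" if "z \<in> carrier G" "\<And>a. a \<in> M \<Longrightarrow> z \<otimes> a = a \<otimes> z" for z
  proof -
    have "insert z M \<in> F"
      using that CM MG Mcomm unfolding F_def by auto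
    then show ?thesis
      using max by blast
  qed
  have sub: "subgroup M G"
  proof
    fix a b
    assume a: "a \<in> M" and b: "b \<in> M"
    have "(a \<otimes> b) \<otimes> c = c \<otimes> (a \<otimes> b)" if c: "c \<in> M" for c
    proof -
      have [simp]: "a \<in> carrier G" "b \<in> carrier G" "c \<in> carrier G"
        using a b c MG by auto
      have "(a \<otimes> b) \<otimes> c = (a \<otimes> c) \<otimes> b"
        using Mcomm[OF b c] by (simp add: m_assoc)
      then show ?thesis
        using Mcomm[OF a c] by (simp add: m_assoc)
    qed
    then show "a \<otimes> b \<in> M"
      using a b MG by (intro centralizer) auto
  next
    show "\<one> \<in> M"
      using MG by (intro centralizer) auto
  next
    fix a
    assume a: "a \<in> M"
    have "inv a \<otimes> c = c \<otimes> inv a" if c: "c \<in> M" for c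
    proof -
      have [simp]: "a \<in> carrier G" "c \<in> carrier G"
        using a c MG by auto
      have "inv a \<otimes> c = inv a \<otimes> (c \<otimes> a) \<otimes> inv a"
        by (simp add: m_assoc)
      also have "\<dots> = inv a \<otimes> (a \<otimes> c) \<otimes> inv a"
        by (simp only: Mcomm[OF c a])
      also have "\<dots> = c \<otimes> inv a"
        by (simp add: m_assoc[symmetric])
      finally show ?thesis .
    qed
    then show "inv a \<in> M"
      using a MG by (intro centralizer) auto
  qed (use MG in blast)
  have "comm_group (G\<lparr>carrier := M\<rparr>)"
    by (rule group.group_comm_groupI[OF subgroup.subgroup_is_group[OF sub is_group]])
       (simp add: Mcomm)
  moreover have "A = M" if A: "abelian_subgroup A G" and "M \<subseteq> A" for A
  proof (rule max)
    interpret A: comm_group "G\<lparr>carrier := A\<rparr>"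
      using A by (simp add: abelian_subgroup_def)
    have "A \<subseteq> carrier G"
      using A by (auto simp: abelian_subgroup_def dest: subgroup.subset)
    then show "A \<in> F"
      using A.m_comm CM \<open>M \<subseteq> A\<close> by (auto simp: F_def)
  qed fact
  ultimately have "maximal_abelian_subgroup M G"
    using sub by (auto simp: maximal_abelian_subgroup_def abelian_subgroup_def)
  then show thesis
    using that CM by blast
qed

text \<open>Writing the conjugation \<open>y = g\<^sup>-\<^sup>1 x g\<close> as \<open>x g = g y\<close> spares the applications from computing
  inverses.\<close>

lemma (in group) CSA_commutes_if_commutes_with_conjugate:
  assumes csa: "CSA G"
    and [simp]: "x \<in> carrier G" "y \<in> carrier G" "g \<in> carrier G"
    and conj: "x \<otimes> g = g \<otimes> y" and comm: "x \<otimes> y = y \<otimes> x"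
  shows "x \<otimes> g = g \<otimes> x"
proof -
  obtain M where M: "maximal_abelian_subgroup M G" and xy: "{x, y} \<subseteq> M"
    by (rule commuting_set_in_maximal_abelian_subgroup[of "{x, y}"]) (use comm in auto)
  show ?thesis
  proof (cases "g \<in> M")
    case True
    interpret M: comm_group "G\<lparr>carrier := M\<rparr>"
      using M by (simp add: maximal_abelian_subgroup_def abelian_subgroup_def)
    show ?thesis
      using M.m_comm True xy by simp
  next
    case False
    have "malnormal M G"
      using csa M by (simp add: CSA_def)
    then have "((inv g <# M) #> g) \<inter> M = {\<one>}"
      using False by (auto simp: malnormal_def)
    moreover have y: "y = inv g \<otimes> x \<otimes> g"
      using conj by (simp add: m_assoc inv_solve_left)
    then have "y \<in> (inv g <# M) #> g"
      using xy by (auto simp: l_coset_def r_coset_def)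
    ultimately have "y = \<one>"
      using xy by blast
    then have "x = \<one>"
      using conj by simp
    then show ?thesis
      by simp
  qed
qed

section \<open>Commutation in the projective special linear group\<close>

lemma pm_one_coset:
  "{mat 1, - mat 1} #>\<^bsub>SL2\<^esub> A = {A, - A}" for A :: "'k::field ^ 2 ^ 2"
proof -
  have "- mat 1 ** A = - A"
    by (simp add: vec_eq_iff matrix_matrix_mult_def mat_def sum_2 forall_2)
  then show ?thesis
    by (auto simp: r_coset_def SL2_def)
qed

lemma PSL2_class_in_carrier:
  "det A = 1 \<Longrightarrow> {A, - A} \<in> carrier PSL2" for A :: "'k::field ^ 2 ^ 2"
  by (auto simp: PSL2_def FactGroup_def RCOSETS_def SL2_def pm_one_coset[unfolded SL2_def])

lemma PSL2_mult_classes: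
  fixes A B :: "'k::field ^ 2 ^ 2"
  assumes "det A = 1" "det B = 1"
  shows "{A, - A} \<otimes>\<^bsub>PSL2\<^esub> {B, - B} = {A ** B, - (A ** B)}"
proof -
  have "A \<in> carrier SL2" "B \<in> carrier SL2" "A \<otimes>\<^bsub>SL2\<^esub> B = A ** B"
    using assms by (simp_all add: SL2_def)
  then show ?thesis
    using normal.rcos_sum[OF normal_pm_one_SL2, of A B]
    by (simp add: PSL2_def FactGroup_def pm_one_coset)
qed

lemma CSA_PSL2_commutes_if_commutes_with_conjugate:
  fixes x y g :: "'k::field ^ 2 ^ 2"
  assumes csa: "CSA (PSL2 :: ('k ^ 2 ^ 2) set monoid)"
    and det: "det x = 1" "det y = 1" "det g = 1"
    and conj: "x ** g = g ** y"
    and comm: "x ** y = y ** x \<or> x ** y = - (y ** x)"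
  shows "x ** g = g ** x \<or> x ** g = - (g ** x)"
proof -
  have "{x, - x} \<otimes>\<^bsub>PSL2\<^esub> {y, - y} = {y, - y} \<otimes>\<^bsub>PSL2\<^esub> {x, - x}"
    using comm by (auto simp: PSL2_mult_classes det)
  moreover have "{x, - x} \<otimes>\<^bsub>PSL2\<^esub> {g, - g} = {g, - g} \<otimes>\<^bsub>PSL2\<^esub> {y, - y}"
    using conj by (simp add: PSL2_mult_classes det)
  ultimately have "{x, - x} \<otimes>\<^bsub>PSL2\<^esub> {g, - g} = {g, - g} \<otimes>\<^bsub>PSL2\<^esub> {x, - x}"
    using group.CSA_commutes_if_commutes_with_conjugate[OF group_PSL2 csa,
        OF PSL2_class_in_carrier PSL2_class_in_carrier PSL2_class_in_carrier,
        of x y g] det by blast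
  then show ?thesis
    by (auto simp: PSL2_mult_classes det doubleton_eq_iff)
qed

section \<open>The witnesses\<close>

definition mat2 :: "'k::field \<Rightarrow> 'k \<Rightarrow> 'k \<Rightarrow> 'k \<Rightarrow> 'k ^ 2 ^ 2" where
  "mat2 a b c d = vector [vector [a, b], vector [c, d]]"

lemma mat2_eq_iff [simp]:
  "mat2 a b c d = mat2 a' b' c' d' \<longleftrightarrow> a = a' \<and> b = b' \<and> c = c' \<and> d = d'"
  by (auto simp: mat2_def vec_eq_iff forall_2)

lemma mat2_mult [simp]:
  "mat2 a b c d ** mat2 a' b' c' d' =
     mat2 (a * a' + b * c') (a * b' + b * d') (c * a' + d * c') (c * b' + d * d')"
  by (simp add: mat2_def vec_eq_iff forall_2 matrix_matrix_mult_def sum_2)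

lemma uminus_mat2 [simp]: "- mat2 a b c d = mat2 (- a) (- b) (- c) (- d)"
  by (simp add: mat2_def vec_eq_iff forall_2)

lemma det_mat2 [simp]: "det (mat2 a b c d) = a * d - b * c"
  by (simp add: mat2_def det_2)

theorem theorem3p3: "\<not> CSA (PSL2 :: ('k::field ^ 2 ^ 2) set monoid)"
proof
  assume csa: "CSA (PSL2 :: ('k ^ 2 ^ 2) set monoid)"
  \<comment> \<open>In each case the three matrices given to \<open>commutes\<close> are \<open>x\<close>, \<open>y = g\<^sup>-\<^sup>1 x g\<close> and \<open>g\<close>,
    in this order.\<close>
  note commutes = CSA_PSL2_commutes_if_commutes_with_conjugate[OF csa]
  consider (two) "(2::'k) = 0" | (three) "(3::'k) = 0" | (six) "(2::'k) \<noteq> 0" "(3::'k) \<noteq> 0"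
    by blast
  then show False
  proof cases
    case two
    then have neg: "- 1 = (1::'k)" and sum: "1 + 1 = (0::'k)"
      by (simp_all add: neg_eq_iff_add_eq_0)
    \<comment> \<open>\<open>x\<close> has order 3, and the involution \<open>g\<close> inverts it.\<close>
    show False
      using commutes[of "mat2 0 1 1 1" "mat2 1 1 1 0" "mat2 0 1 1 0"]
      by (simp add: neg sum two)
  next
    case three
    have r: "(2::'k) = - 1"
      using three by (simp add: eq_neg_iff_add_eq_0)
    \<comment> \<open>\<open>x\<close> and \<open>y\<close> generate a quaternion group, whose image is a Klein four-group that \<open>g\<close>
      normalizes without centralizing it; \<open>x\<close> and \<open>y\<close> anticommute.\<close>
    show False
      using commutes[of "mat2 0 1 (- 1) 0" "mat2 1 2 (- 1) (- 1)" "mat2 1 1 0 1"]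
      by (simp add: r)
  next
    case six
    have four: "(4::'k) \<noteq> 0"
      using six by (metis mult_eq_0_iff numeral_times_numeral semiring_norm(11) semiring_norm(13))
    have "(3::'k) = 4 - 1"
      by simp
    then have "(4::'k) \<noteq> 1"
      using six(2) by (metis diff_self)
    \<comment> \<open>\<open>x\<close> and \<open>y\<close> are unitriangular, hence commute; conjugation by \<open>g\<close> divides the corner entry
      by \<open>4 \<noteq> 1\<close>. The sign \<open>- 1\<close> is excluded by the upper left entry, as \<open>2 \<noteq> - 2\<close>.\<close>
    show False
      using commutes[of "mat2 1 1 0 1" "mat2 1 (1/4) 0 1" "mat2 2 0 0 (1/2)"] six four \<open>4 \<noteq> 1\<close>
      by (auto simp: field_simps)
  qed
qed

end
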